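(* Let $p$ be a prime and let $a,b,c,d$ be integers with $0\le b\le a$. Then $$S(p^\infty a+c,p^\infty b+d)=\begin{cases}0&\text{if } d=0,\ c\ne0,\\ 0&\text{if } d<0,\ c\ge0,\\ |s(|d|,|c|)|\,S(p^\infty a,p^\infty b)&\text{if } c<0,\ d<0.\end{cases}$$
   Context: $\mathbb{Z}_p$ denotes the $p$-adic integers. $S(n,k)$ denotes the Stirling numbers of the second kind, with $S(0,0)=1$ and $S(n,k)=kS(n-1,k)+S(n-1,k-1)$; $|s(n,k)|$ denotes the unsigned Stirling numbers of the first kind. Define $S(p^\infty a+c,p^\infty b+d):=\lim_{e\to\infty}S(p^e a+c,p^e b+d)$, the limit being taken in $\mathbb{Z}_p$ (its existence is part of the assertion). Convention for negative arguments (relevant only in the degenerate cases $a=0$, or $b=0$ and $d<0$): $S$ is extended to all pairs of integers by the same recurrence, i.e. $S(n,k)=0$ if exactly one of $n,k$ is negative, and $S(-n,-k)=|s(k,n)|$ for $n,k\ge1$. *)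

theory Defs
  imports
    "HOL-Analysis.Analysis"
    "HOL-Algebra.Ring"
    "HOL-Combinatorics.Stirling"
    "HOL-Computational_Algebra.Primes"
begin

text \<open>
  The ring \<open>\<int>\<^sub>p\<close> as the inverse limit of the rings \<open>\<int>/p\<^sup>n\<close>: an element is a coherent sequence
  \<open>x\<close>, where \<open>x n \<in> {0..<p\<^sup>n}\<close> represents the residue class modulo \<open>p\<^sup>n\<close>.
\<close>

definition padic_int :: "nat \<Rightarrow> (nat \<Rightarrow> int) ring" where
  "padic_int p =
     \<lparr>carrier = {x. \<forall>n. x n \<in> {0..<int p ^ n} \<and> x (Suc n) mod int p ^ n = x n},
      mult = (\<lambda>x y n. (x n * y n) mod int p ^ n),
      one = (\<lambda>n. 1 mod int p ^ n),
      zero = (\<lambda>n. 0),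
      add = (\<lambda>x y n. (x n + y n) mod int p ^ n)\<rparr>"

definition padic_of_int :: "nat \<Rightarrow> int \<Rightarrow> (nat \<Rightarrow> int)" where
  "padic_of_int p k = (\<lambda>n. k mod int p ^ n)"

text \<open>The \<open>p\<close>-adic topology is the inverse limit topology of the discrete spaces \<open>\<int>/p\<^sup>n\<close>.\<close>

definition padic_topology :: "nat \<Rightarrow> (nat \<Rightarrow> int) topology" where
  "padic_topology p =
     subtopology (product_topology (\<lambda>n. discrete_topology {0..<int p ^ n}) UNIV)
       (carrier (padic_int p))"

definition padic_convergent :: "nat \<Rightarrow> (nat \<Rightarrow> int) \<Rightarrow> bool" where
  "padic_convergent p u \<longleftrightarrow>
     (\<exists>L. limitin (padic_topology p) (\<lambda>e. padic_of_int p (u e)) L sequentially)"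

definition padic_lim :: "nat \<Rightarrow> (nat \<Rightarrow> int) \<Rightarrow> (nat \<Rightarrow> int)" where
  "padic_lim p u =
     (THE L. limitin (padic_topology p) (\<lambda>e. padic_of_int p (u e)) L sequentially)"

text \<open>
  \<open>S\<close> is \<open>Stirling\<close> (second kind), \<open>|s|\<close> is \<open>stirling\<close> (unsigned, first kind). For \<open>n, k \<ge> 1\<close>,
  \<open>S(-n, -k) = |s(k, n)|\<close>, which extends the recurrence to all integers: see \<open>int_Stirling_rec\<close>.
\<close>

definition int_Stirling :: "int \<Rightarrow> int \<Rightarrow> int" where
  "int_Stirling n k =
     (if n \<ge> 0 \<and> k \<ge> 0 then int (Stirling (nat n) (nat k))
      else if n < 0 \<and> k < 0 then int (stirling (nat (- k)) (nat (- n)))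
      else 0)"

definition Stirling_seq :: "nat \<Rightarrow> int \<Rightarrow> int \<Rightarrow> int \<Rightarrow> int \<Rightarrow> nat \<Rightarrow> int" where
  "Stirling_seq p a c b d = (\<lambda>e. int_Stirling (int p ^ e * a + c) (int p ^ e * b + d))"

text \<open>\<open>padic_Stirling p a c b d\<close> is \<open>S(p\<^sup>\<infinity>a + c, p\<^sup>\<infinity>b + d)\<close>; it is meaningful only if the sequence
  \<open>Stirling_seq p a c b d\<close> is \<open>padic_convergent\<close>.\<close>

definition padic_Stirling :: "nat \<Rightarrow> int \<Rightarrow> int \<Rightarrow> int \<Rightarrow> int \<Rightarrow> (nat \<Rightarrow> int)" where
  "padic_Stirling p a c b d = padic_lim p (Stirling_seq p a c b d)"

lemma padic_int_simps:
  "x \<in> carrier (padic_int p) \<longleftrightarrow>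
     (\<forall>n. 0 \<le> x n \<and> x n < int p ^ n \<and> x (Suc n) mod int p ^ n = x n)"
  "x \<otimes>\<^bsub>padic_int p\<^esub> y = (\<lambda>n. (x n * y n) mod int p ^ n)"
  "x \<oplus>\<^bsub>padic_int p\<^esub> y = (\<lambda>n. (x n + y n) mod int p ^ n)"
  "\<one>\<^bsub>padic_int p\<^esub> = (\<lambda>n. 1 mod int p ^ n)"
  "\<zero>\<^bsub>padic_int p\<^esub> = (\<lambda>n. 0)"
  by (auto simp: padic_int_def)

lemma padic_of_int_closed:
  assumes "p > 0" shows "padic_of_int p k \<in> carrier (padic_int p)"
  using assms by (simp add: padic_int_simps padic_of_int_def mod_mod_cancel)

lemma padic_closed_lift:
  assumes "p > 0" and "\<And>n. f (Suc n) mod int p ^ n = f n mod int p ^ n"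
  shows "(\<lambda>n. f n mod int p ^ n) \<in> carrier (padic_int p)"
  using assms by (simp add: padic_int_simps mod_mod_cancel)

lemma cring_padic_int:
  assumes "p > 0" shows "cring (padic_int p)"
proof -
  have red: "x n mod int p ^ n = x n" if "x \<in> carrier (padic_int p)" for x n
    using that by (simp add: padic_int_simps)
  have coh: "x (Suc n) mod int p ^ n = x n mod int p ^ n" if "x \<in> carrier (padic_int p)" for x n
    using that by (simp add: padic_int_simps)
  have mclosed: "x \<otimes>\<^bsub>padic_int p\<^esub> y \<in> carrier (padic_int p)"
    and aclosed: "x \<oplus>\<^bsub>padic_int p\<^esub> y \<in> carrier (padic_int p)"
    if "x \<in> carrier (padic_int p)" "y \<in> carrier (padic_int p)" for x y
    unfolding padic_int_simps(2,3)
    by (intro padic_closed_lift assms mod_mult_cong mod_add_cong coh that)+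
  have one: "\<one>\<^bsub>padic_int p\<^esub> \<in> carrier (padic_int p)"
    using padic_of_int_closed[OF assms, of 1] by (simp add: padic_int_simps(4) padic_of_int_def)
  have zero: "\<zero>\<^bsub>padic_int p\<^esub> \<in> carrier (padic_int p)"
    using assms by (simp add: padic_int_simps)
  have neg: "\<exists>y\<in>carrier (padic_int p). y \<oplus>\<^bsub>padic_int p\<^esub> x = \<zero>\<^bsub>padic_int p\<^esub>"
    if x: "x \<in> carrier (padic_int p)" for x
  proof (rule bexI)
    show "(\<lambda>n. (- x n) mod int p ^ n) \<oplus>\<^bsub>padic_int p\<^esub> x = \<zero>\<^bsub>padic_int p\<^esub>"
      by (simp add: padic_int_simps mod_simps)
    show "(\<lambda>n. (- x n) mod int p ^ n) \<in> carrier (padic_int p)"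
      by (intro padic_closed_lift assms mod_minus_cong coh x)
  qed
  show ?thesis
  proof (intro cringI abelian_groupI comm_monoidI)
  qed ((blast intro: mclosed aclosed one zero neg
      | (auto simp: padic_int_simps(2-5) red mod_simps algebra_simps; fail))+)
qed

lemma Hausdorff_padic_topology: "Hausdorff_space (padic_topology p)"
  unfolding padic_topology_def
  by (intro Hausdorff_space_subtopology)
     (simp add: Hausdorff_space_product_topology Hausdorff_space_discrete_topology)

lemma limitin_padic_topology_iff:
  assumes "p > 0"
  shows "limitin (padic_topology p) (\<lambda>e. padic_of_int p (u e)) L sequentially \<longleftrightarrow>
           L \<in> carrier (padic_int p) \<and>
           (\<forall>n. \<forall>\<^sub>F e in sequentially. u e mod int p ^ n = L n)"
proof -
  have disc: "limitin (discrete_topology {0..<int p ^ n}) (\<lambda>e. u e mod int p ^ n) (L n) sequentially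
      \<longleftrightarrow> L n \<in> {0..<int p ^ n} \<and> (\<forall>\<^sub>F e in sequentially. u e mod int p ^ n = L n)" for n
  proof
    assume *: "limitin (discrete_topology {0..<int p ^ n}) (\<lambda>e. u e mod int p ^ n) (L n) sequentially"
    then have "L n \<in> {0..<int p ^ n}"
      by (simp add: limitin_def)
    with * show "L n \<in> {0..<int p ^ n} \<and> (\<forall>\<^sub>F e in sequentially. u e mod int p ^ n = L n)"
      unfolding limitin_def by (auto dest!: spec[of _ "{L n}"])
  next
    assume *: "L n \<in> {0..<int p ^ n} \<and> (\<forall>\<^sub>F e in sequentially. u e mod int p ^ n = L n)"
    then show "limitin (discrete_topology {0..<int p ^ n}) (\<lambda>e. u e mod int p ^ n) (L n) sequentially"
      by (auto simp: limitin_def elim!: eventually_mono)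
  qed
  show ?thesis
    unfolding padic_topology_def limitin_subtopology limitin_componentwise
    using padic_of_int_closed[OF assms] assms
    by (auto simp: disc padic_of_int_def padic_int_simps(1) PiE_def)
qed

lemma padic_lim_eqI:
  assumes "limitin (padic_topology p) (\<lambda>e. padic_of_int p (u e)) L sequentially"
  shows "padic_lim p u = L"
  unfolding padic_lim_def
proof (rule the_equality[where P = "\<lambda>L. limitin _ _ L _", OF assms])
  fix L'
  assume "limitin (padic_topology p) (\<lambda>e. padic_of_int p (u e)) L' sequentially"
  then show "L' = L"
    using limitin_Hausdorff_unique[OF _ assms trivial_limit_sequentially Hausdorff_padic_topology]
    by blast
qed

lemma int_Stirling_0_0: "int_Stirling 0 0 = 1"
  by (simp add: int_Stirling_def)

lemma int_Stirling_rec: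
  "int_Stirling n k = k * int_Stirling (n - 1) k + int_Stirling (n - 1) (k - 1)"
proof -
  consider "n > 0" | "n \<le> 0" "k > 0" | "n \<le> 0" "k \<le> 0"
    by linarith
  then show ?thesis
  proof cases
    case 1
    then obtain m where m: "n = int (Suc m)"
      by (metis gr0_conv_Suc zero_less_imp_eq_int)
    show ?thesis
    proof (cases "k > 0")
      case True
      then obtain j where "k = int (Suc j)"
        by (metis gr0_conv_Suc zero_less_imp_eq_int)
      then show ?thesis
        by (simp add: m int_Stirling_def nat_add_distrib algebra_simps)
    qed (auto simp: m int_Stirling_def nat_add_distrib)
  next
    case 2
    then show ?thesis
      by (cases "n = 0"; cases "nat k") (auto simp: int_Stirling_def)
  next
    case 3
    then obtain m j where mj: "n = - int m" "k = - int j"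
      by (metis minus_minus neg_0_le_iff_le nonneg_int_cases)
    have nats: "nat (1 + int i) = Suc i" for i
      by simp
    show ?thesis
      by (cases m; cases j) (auto simp: mj int_Stirling_def nats algebra_simps nat_add_distrib)
  qed
qed

end

theory Submission
  imports Defs
begin

text \<open>
  Let \<open>G\<^sub>k = \<Sum>\<^sub>n S(n + k, k) x\<^sup>n = \<Prod>\<^sub>i\<^sub>\<le>\<^sub>k (1 - i x)\<^sup>-\<^sup>1\<close>. The factors are periodic in \<open>i\<close> modulo \<open>K\<close>,
  hence \<open>G\<^sub>K\<^sub>j\<close> is congruent to the \<open>j\<close>-th power of \<open>G\<^sub>K\<close> modulo \<open>K\<close>. With \<open>K = p\<^sup>N\<close> and \<open>j = p\<^sup>m b\<close>, the
  series becomes a \<open>p\<^sup>m\<close>-th power. Now \<open>f(x)\<^sup>p\<close> is congruent to \<open>f(x\<^sup>p)\<close> modulo \<open>p\<close>, and raising this to the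
  power \<open>p\<^sup>m\<close> gives a congruence modulo \<open>p\<^sup>m\<^sup>+\<^sup>1\<close>. It shows that \<open>S(p\<^sup>e a, p\<^sup>e b)\<close> is Cauchy and, since
  coefficients at exponents not divisible by a high power of \<open>p\<close> are nearly \<open>0\<close>, that
  \<open>S(p\<^sup>e a + c, p\<^sup>e b)\<close> tends to \<open>0\<close> for \<open>c \<noteq> 0\<close>. Running the recurrence of \<open>S\<close> downwards in \<open>k\<close> from \<open>K = p\<^sup>e b\<close>
  shows that \<open>S(n, K - D)\<close> is congruent to \<open>\<Sum>\<^sub>j |s(D, j)| S(n + j, K)\<close> modulo \<open>K\<close>; in the limit only
  \<open>j = -c\<close> survives.
\<close>

unbundle no vec_syntax
unbundle fps_syntax

section \<open>Congruences for powers\<close>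

lemma of_nat_prime_dvd_power_add:
  fixes x y :: "'a::comm_ring_1"
  assumes "prime p"
  shows "of_nat p dvd (x + y) ^ p - (x ^ p + y ^ p)"
proof -
  have "{..p} = insert 0 (insert p {1..<p})"
    using prime_gt_0_nat[OF assms] by auto
  then have "(x + y) ^ p = x ^ p + y ^ p + (\<Sum>k\<in>{1..<p}. of_nat (p choose k) * x ^ k * y ^ (p - k))"
    using prime_gt_0_nat[OF assms] by (simp add: binomial_ring algebra_simps)
  moreover have "of_nat p dvd (\<Sum>k\<in>{1..<p}. of_nat (p choose k) * x ^ k * y ^ (p - k))"
  proof (intro dvd_sum dvd_mult2)
    fix k
    assume "k \<in> {1..<p}"
    then have "p dvd p choose k"
      using assms by (intro dvd_choose_prime) auto
    then show "of_nat p dvd (of_nat (p choose k) :: 'a)"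
      by (auto elim!: dvdE)
  qed
  ultimately show ?thesis
    by simp
qed

text \<open>Fermat's little theorem: additivity of the \<open>p\<close>-th power modulo
  \<open>p\<close> carries it from \<open>c\<close> to \<open>c + 1\<close> and to
  \<open>c - 1\<close>.\<close>

lemma prime_dvd_power_diff_self:
  fixes c :: int
  assumes "prime p"
  shows "int p dvd c ^ p - c"
proof (induction c rule: int_induct[where k = 0])
  case base
  then show ?case
    using prime_gt_0_nat[OF assms] by (simp add: zero_power)
next
  case (step1 i)
  have "int p dvd ((i + 1) ^ p - (i ^ p + 1 ^ p)) + (i ^ p - i)"
    using of_nat_prime_dvd_power_add[OF assms, of i 1] step1 by (intro dvd_add) simp_all
  then show ?case
    by (simp add: algebra_simps)
next
  case (step2 i)
  have "int p dvd (i ^ p - i) - ((i - 1 + 1) ^ p - ((i - 1) ^ p + 1 ^ p))"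
    by (intro dvd_diff[OF step2(2)] of_nat_prime_dvd_power_add assms)
  then show ?case
    by (simp add: algebra_simps)
qed

lemma dvd_power_diff:
  fixes x y :: "'a::comm_ring_1"
  assumes "m dvd x - y"
  shows "m dvd x ^ n - y ^ n"
  using assms by (simp add: power_diff_sumr2)

text \<open>The cofactor of \<open>x - y\<close> in \<open>x ^ p - y ^ p\<close> has
  \<open>p\<close> summands, each congruent to \<open>y ^ (p - 1)\<close> modulo \<open>p\<close>.
  Hence every \<open>p\<close>-th power gains a factor \<open>p\<close>.\<close>

lemma dvd_power_diff_lift:
  fixes x y :: "'a::comm_ring_1"
  assumes "of_nat p dvd x - y" "m dvd x - y"
  shows "m * of_nat p dvd x ^ p - y ^ p"
proof -
  have "of_nat p dvd (\<Sum>i<p. y ^ (p - Suc i) * (x ^ i - y ^ i) + y ^ (p - 1))"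
  proof -
    have "of_nat p dvd (\<Sum>i<p. y ^ (p - Suc i) * (x ^ i - y ^ i)) + of_nat p * y ^ (p - 1)"
      using assms(1) by (intro dvd_add[OF dvd_sum dvd_triv_left] dvd_mult dvd_power_diff)
    then show ?thesis
      by (simp add: sum.distrib)
  qed
  also have "(\<Sum>i<p. y ^ (p - Suc i) * (x ^ i - y ^ i) + y ^ (p - 1)) = (\<Sum>i<p. y ^ (p - Suc i) * x ^ i)"
    by (rule sum.cong) (auto simp: right_diff_distrib simp flip: power_add)
  finally show ?thesis
    using assms(2) by (simp add: power_diff_sumr2 mult_dvd_mono)
qed

lemma dvd_power_prime_power_diff:
  fixes x y :: "'a::comm_ring_1"
  assumes "of_nat p dvd x - y"
  shows "of_nat (p ^ Suc m) dvd x ^ (p ^ m) - y ^ (p ^ m)"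
proof (induction m)
  case 0
  then show ?case using assms by simp
next
  case (Suc m)
  have "of_nat p dvd x ^ (p ^ m) - y ^ (p ^ m)"
    using assms by (rule dvd_power_diff)
  from dvd_power_diff_lift[OF this Suc] show ?case
    by (simp add: power_mult mult.commute flip: power_mult)
qed

section \<open>The Frobenius congruence for integer power series\<close>

lemma of_nat_dvd_fps_iff:
  fixes f :: "int fps"
  shows "of_nat m dvd f \<longleftrightarrow> (\<forall>n. int m dvd f $ n)"
proof
  assume "of_nat m dvd f"
  then show "\<forall>n. int m dvd f $ n"
    by (auto simp: dvd_def simp flip: fps_of_nat)
next
  assume "\<forall>n. int m dvd f $ n"
  then have "f = of_nat m * Abs_fps (\<lambda>n. f $ n div int m)"
    by (auto simp: fps_eq_iff simp flip: fps_of_nat)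
  then show "of_nat m dvd f"
    by (metis dvd_triv_left)
qed

lemma fps_nth_compose_X_power:
  fixes f :: "'a::comm_ring_1 fps"
  assumes "k > 0"
  shows "(f oo fps_X ^ k) $ n = (if k dvd n then f $ (n div k) else 0)"
proof -
  have "((fps_X ^ k) ^ i :: 'a fps) $ n = (if n = k * i then 1 else 0)" for i
    unfolding power_mult[symmetric] by (simp add: fps_X_power_iff)
  then have "(f oo fps_X ^ k) $ n = (\<Sum>i = 0..n. if n = k * i then f $ i else 0)"
    by (auto simp: fps_compose_nth intro!: sum.cong)
  also have "\<dots> = (\<Sum>i = 0..n. if i = n div k then (if k dvd n then f $ i else 0) else 0)"
    using assms by (intro sum.cong) auto
  also have "\<dots> = (if k dvd n then f $ (n div k) else 0)"
    by (simp add: sum.delta)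
  finally show ?thesis .
qed

text \<open>Split \<open>f = c + X q\<close>. Then \<open>f ^ p\<close> is congruent to
  \<open>c ^ p + X ^ p q ^ p\<close>: Fermat handles the constant term, and the coefficient at
  \<open>n\<close> reduces to that of \<open>q\<close> at \<open>n - p\<close>.\<close>

lemma fps_frobenius_nth:
  fixes f :: "int fps"
  assumes p: "prime p"
  shows "int p dvd (f ^ p) $ n - (f oo fps_X ^ p) $ n"
proof (induction n arbitrary: f rule: less_induct)
  case (less n)
  have p0: "p > 0"
    using p by (rule prime_gt_0_nat)
  define c q where "c = f $ 0" and "q = fps_shift 1 f"
  have f: "f = fps_const c + fps_X * q"
    by (rule fps_ext) (auto simp: c_def q_def)
  have "int p dvd ((fps_const c + fps_X * q) ^ p - (fps_const c ^ p + (fps_X * q) ^ p)) $ n"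
    using of_nat_prime_dvd_power_add[OF p, of "fps_const c" "fps_X * q"] of_nat_dvd_fps_iff by blast
  then have 1: "int p dvd (f ^ p) $ n - (fps_const (c ^ p) + fps_X ^ p * q ^ p) $ n"
    by (simp add: f power_mult_distrib fps_const_power)
  have 2: "int p dvd (fps_const (c ^ p) + fps_X ^ p * q ^ p) $ n - (f oo fps_X ^ p) $ n"
  proof (cases "n = 0")
    case True
    show ?thesis
      using True p0 prime_dvd_power_diff_self[OF p, of c]
      by (simp add: fps_nth_compose_X_power fps_X_power_mult_nth flip: c_def)
  next
    case False
    show ?thesis
    proof (cases "n < p")
      case True
      then show ?thesis
        using False p0 by (auto simp: fps_nth_compose_X_power fps_X_power_mult_nth dest: dvd_imp_le)
    next
      case le: False
      then have "(f oo fps_X ^ p) $ n = (q oo fps_X ^ p) $ (n - p)"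
        using p0 by (auto simp: fps_nth_compose_X_power q_def le_div_geq dvd_minus_self)
      then show ?thesis
        using False le less[of "n - p" q] p0 by (simp add: fps_X_power_mult_nth)
    qed
  qed
  show ?case
    using dvd_add[OF 1 2] by simp
qed

lemma fps_frobenius:
  fixes f :: "int fps"
  assumes "prime p"
  shows "of_nat p dvd f ^ p - (f oo fps_X ^ p)"
  using fps_frobenius_nth[OF assms] by (simp add: of_nat_dvd_fps_iff)

lemma fps_nth_power_prime_power:
  fixes f :: "int fps"
  assumes p: "prime p"
  shows "int (p ^ Suc m) dvd
    (f ^ (p ^ Suc m)) $ n - (if p dvd n then (f ^ (p ^ m)) $ (n div p) else 0)"
proof -
  have p0: "p > 0"
    using p by (rule prime_gt_0_nat)
  have "of_nat (p ^ Suc m) dvd (f ^ p) ^ (p ^ m) - (f oo fps_X ^ p) ^ (p ^ m)"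
    by (intro dvd_power_prime_power_diff fps_frobenius p)
  also have "(f oo fps_X ^ p) ^ (p ^ m) = f ^ (p ^ m) oo fps_X ^ p"
    using p0 by (simp add: fps_compose_power)
  also have "(f ^ p) ^ (p ^ m) = f ^ (p ^ Suc m)"
    by (simp add: power_mult)
  finally have "int (p ^ Suc m) dvd (f ^ (p ^ Suc m) - (f ^ (p ^ m) oo fps_X ^ p)) $ n"
    unfolding of_nat_dvd_fps_iff by blast
  then show ?thesis
    unfolding fps_sub_nth fps_nth_compose_X_power[OF p0] .
qed

text \<open>Each factor \<open>p\<close> stripped from \<open>n\<close> costs one factor
  \<open>p\<close> of the exponent. After fewer than \<open>s\<close> strippings the index is prime
  to \<open>p\<close>, where the coefficient vanishes modulo \<open>p ^ m\<close>.\<close>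

lemma fps_nth_power_prime_power_dvd:
  fixes f :: "int fps"
  assumes p: "prime p" and "\<not> p ^ s dvd n"
  shows "int (p ^ m) dvd (f ^ (p ^ (m + s))) $ n"
  using assms(2)
proof (induction s arbitrary: n)
  case 0
  then show ?case by simp
next
  case (Suc s)
  have "int (p ^ m) dvd int (p ^ Suc (m + s))"
    by (simp add: power_add)
  from dvd_trans[OF this fps_nth_power_prime_power[OF p]]
  have 1: "int (p ^ m) dvd (f ^ (p ^ Suc (m + s))) $ n
    - (if p dvd n then (f ^ (p ^ (m + s))) $ (n div p) else 0)" .
  have 2: "int (p ^ m) dvd (if p dvd n then (f ^ (p ^ (m + s))) $ (n div p) else 0)"
    using Suc prime_gt_0_nat[OF p] by auto
  show ?case
    using dvd_add[OF 1 2] by (simp only: add_Suc_right diff_add_cancel)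
qed

section \<open>The generating function of the Stirling numbers of the second kind\<close>

definition Stirling_fps :: "nat \<Rightarrow> int fps" where
  "Stirling_fps k = Abs_fps (\<lambda>n. int (Stirling (n + k) k))"

lemma Stirling_fps_0: "Stirling_fps 0 = 1"
  by (rule fps_ext) (auto simp: Stirling_fps_def gr0_conv_Suc)

text \<open>The recurrence, read coefficientwise; this is the division-free form of the product
  formula.\<close>

lemma Stirling_fps_Suc:
  "Stirling_fps (Suc k) * (1 - of_nat (Suc k) * fps_X) = Stirling_fps k"
proof (rule fps_ext)
  fix n
  have "Stirling_fps (Suc k) * (1 - of_nat (Suc k) * fps_X)
      = Stirling_fps (Suc k) - fps_const (int (Suc k)) * (Stirling_fps (Suc k) * fps_X)"
    by (simp add: fps_of_nat right_diff_distrib mult_ac del: of_nat_Suc)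
  then show "(Stirling_fps (Suc k) * (1 - of_nat (Suc k) * fps_X)) $ n = Stirling_fps k $ n"
    by (cases n) (simp_all add: Stirling_fps_def algebra_simps)
qed

text \<open>The factors \<open>A\<close> and \<open>B\<close> that enter on the two sides agree
  modulo \<open>K\<close>. Since \<open>A\<close> is a unit, with a geometric series as inverse, it
  can be cancelled from the divisibility.\<close>

lemma Stirling_fps_add:
  "of_nat K dvd Stirling_fps (K + k) - Stirling_fps K * Stirling_fps k"
proof (induction k)
  case 0
  then show ?case by (simp add: Stirling_fps_0)
next
  case (Suc k)
  define A B where "A = 1 - of_nat (Suc (K + k)) * (fps_X :: int fps)"
    and "B = 1 - of_nat (Suc k) * (fps_X :: int fps)"
  have AB: "A = B - of_nat K * fps_X"
    by (simp add: A_def B_def algebra_simps)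
  have A: "Stirling_fps (Suc (K + k)) * A = Stirling_fps (K + k)"
    unfolding A_def by (rule Stirling_fps_Suc)
  have B: "Stirling_fps (Suc k) * B = Stirling_fps k"
    unfolding B_def by (rule Stirling_fps_Suc)
  have "(Stirling_fps (Suc (K + k)) - Stirling_fps K * Stirling_fps (Suc k)) * A
      = (Stirling_fps (K + k) - Stirling_fps K * Stirling_fps k)
        + of_nat K * (fps_X * Stirling_fps K * Stirling_fps (Suc k))"
    unfolding A[symmetric] B[symmetric] AB by (simp add: algebra_simps)
  then have "of_nat K dvd (Stirling_fps (Suc (K + k)) - Stirling_fps K * Stirling_fps (Suc k)) * A"
    using Suc by simp
  then have "of_nat K dvd (Stirling_fps (Suc (K + k)) - Stirling_fps K * Stirling_fps (Suc k)) * A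
     * Abs_fps (\<lambda>n. int (Suc (K + k)) ^ n)"
    by (rule dvd_mult2)
  moreover have "A * Abs_fps (\<lambda>n. int (Suc (K + k)) ^ n) = 1"
  proof (rule fps_ext)
    fix n
    show "(A * Abs_fps (\<lambda>n. int (Suc (K + k)) ^ n)) $ n = 1 $ n"
      by (cases n) (simp_all add: A_def left_diff_distrib mult.assoc del: of_nat_Suc flip: fps_of_nat)
  qed
  ultimately show ?case
    by (simp add: mult.assoc)
qed

lemma Stirling_fps_mult:
  "of_nat K dvd Stirling_fps (K * j) - Stirling_fps K ^ j"
proof (induction j)
  case 0
  then show ?case by (simp add: Stirling_fps_0)
next
  case (Suc j)
  have "of_nat K dvd (Stirling_fps (K + K * j) - Stirling_fps K * Stirling_fps (K * j))
      + Stirling_fps K * (Stirling_fps (K * j) - Stirling_fps K ^ j)"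
    using Suc by (intro dvd_add Stirling_fps_add dvd_mult)
  then show ?case
    by (simp add: algebra_simps)
qed

lemma int_Stirling_conv_fps:
  assumes "k \<ge> 0"
  shows "int_Stirling n k = (if k \<le> n then Stirling_fps (nat k) $ nat (n - k) else 0)"
  using assms by (auto simp: int_Stirling_def Stirling_fps_def simp flip: nat_add_distrib)

section \<open>The residues of \<open>S(p\<^sup>e a + c, p\<^sup>e b + d)\<close>\<close>

text \<open>Splitting the exponent as \<open>N + e\<close> serves two ends: blocks of length
  \<open>p ^ N\<close> give the modulus, and the remaining \<open>p ^ e\<close> makes the series a
  \<open>p ^ e\<close>-th power.\<close>

lemma int_Stirling_prime_power_cong:
  assumes "p > 0" "b \<ge> 0" "n \<ge> int p ^ (N + e) * b"
  shows "int (p ^ N) dvd int_Stirling n (int p ^ (N + e) * b)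
    - ((Stirling_fps (p ^ N) ^ nat b) ^ (p ^ e)) $ nat (n - int p ^ (N + e) * b)"
proof -
  have "nat (int p ^ (N + e) * b) = p ^ N * (nat b * p ^ e)"
    using assms by (simp add: nat_mult_distrib nat_power_eq power_add)
  moreover have "int (p ^ N) dvd (Stirling_fps (p ^ N * (nat b * p ^ e))
     - Stirling_fps (p ^ N) ^ (nat b * p ^ e)) $ nat (n - int p ^ (N + e) * b)"
    using Stirling_fps_mult of_nat_dvd_fps_iff by blast
  ultimately show ?thesis
    using assms by (simp add: int_Stirling_conv_fps power_mult)
qed

lemma eventually_Stirling_seq_0:
  assumes p: "prime p" and b: "b \<ge> 0" and c: "c \<noteq> 0"
  shows "\<forall>\<^sub>F e in sequentially. int p ^ N dvd Stirling_seq p a c b 0 e"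
proof -
  have p1: "p > 1"
    using p by (rule prime_gt_1_nat)
  \<comment> \<open>As \<open>p ^ s > s = \<bar>c\<bar> > 0\<close>, the power \<open>p ^ s\<close>
    does not divide \<open>c\<close>, and so not \<open>p ^ e * (a - b) + c\<close> once
    \<open>e \<ge> s\<close>.\<close>
  define s where "s = nat \<bar>c\<bar>"
  have s: "\<not> int p ^ s dvd c"
  proof
    assume "int p ^ s dvd c"
    then have "int p ^ s \<le> int s"
      using c dvd_imp_le_int[of c "int p ^ s"] by (simp add: s_def)
    moreover have "s < p ^ s"
      using p1 by (simp add: power_gt_expt)
    ultimately show False
      by (simp flip: of_nat_power)
  qed
  have "int p ^ N dvd Stirling_seq p a c b 0 e" if e: "e \<ge> N + (N + s)" for e
  proof (cases "int p ^ e * b \<le> int p ^ e * a + c")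
    case True
    \<comment> \<open>The first \<open>N\<close> is the block length, \<open>s\<close> pays for the
      non-divisibility, and \<open>N + r\<close> is left as the exponent of the divisor.\<close>
    obtain r where r: "e = N + (N + r + s)"
      using e by (metis le_Suc_ex add.assoc add.commute)
    define n where "n = nat (int p ^ e * a + c - int p ^ e * b)"
    have n: "int n = int p ^ e * (a - b) + c"
      using True by (simp add: n_def algebra_simps)
    have "int p ^ s dvd int p ^ e"
      by (rule le_imp_power_dvd) (simp add: r)
    then have "\<not> int (p ^ s) dvd int n"
      unfolding n using s by (simp add: dvd_add_right_iff)
    then have "\<not> p ^ s dvd n"
      by presburger
    then have "int (p ^ (N + r)) dvd ((Stirling_fps (p ^ N) ^ nat b) ^ (p ^ (N + r + s))) $ n"
      by (rule fps_nth_power_prime_power_dvd[OF p])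
    then have "int (p ^ N) dvd ((Stirling_fps (p ^ N) ^ nat b) ^ (p ^ (N + r + s))) $ n"
      by (rule dvd_trans[rotated]) (simp add: power_add)
    moreover have "int (p ^ N) dvd int_Stirling (int p ^ e * a + c) (int p ^ e * b)
        - ((Stirling_fps (p ^ N) ^ nat b) ^ (p ^ (N + r + s))) $ n"
      using int_Stirling_prime_power_cong[of p b N "N + r + s"] p1 b True by (simp add: n_def r)
    ultimately have "int (p ^ N) dvd int_Stirling (int p ^ e * a + c) (int p ^ e * b)"
      by (metis dvd_add diff_add_cancel)
    then show ?thesis
      by (simp add: Stirling_seq_def)
  next
    \<comment> \<open>The upper index lies below the nonnegative lower one, so the number is
      \<open>0\<close>, also when the upper index is negative.\<close>
    case False
    then show ?thesis
      using b by (simp add: Stirling_seq_def int_Stirling_conv_fps)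
  qed
  then show ?thesis
    unfolding eventually_sequentially by blast
qed

text \<open>Passing from \<open>e\<close> to \<open>e + 1\<close> multiplies both the coefficient
  index \<open>n\<close> and the power of the series by \<open>p\<close>, which is the situation of
  \<open>fps_nth_power_prime_power\<close>.\<close>

lemma eventually_Stirling_seq_Suc:
  assumes p: "prime p" and "0 \<le> b" "b \<le> a"
  shows "\<forall>\<^sub>F e in sequentially.
    int p ^ N dvd Stirling_seq p a 0 b 0 (Suc e) - Stirling_seq p a 0 b 0 e"
proof -
  have p0: "p > 0"
    using p by (rule prime_gt_0_nat)
  have "int p ^ N dvd Stirling_seq p a 0 b 0 (Suc e) - Stirling_seq p a 0 b 0 e"
    if e: "e \<ge> N + N" for e
  proof -
    obtain m where m: "e = N + m" "m \<ge> N"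
      using e by (metis le_Suc_ex add.assoc le_add1)
    define f where "f = Stirling_fps (p ^ N) ^ nat b"
    define n where "n = p ^ e * nat (a - b)"
    have n: "nat (int p ^ i * a - int p ^ i * b) = p ^ i * nat (a - b)" for i
      by (simp add: nat_mult_distrib nat_power_eq flip: right_diff_distrib)
    have "int (p ^ N) dvd int (p ^ Suc m)"
      unfolding of_nat_dvd_iff using m(2) by (intro le_imp_power_dvd) simp
    then have 1: "int (p ^ N) dvd (f ^ (p ^ Suc m)) $ (p * n) - (f ^ (p ^ m)) $ n"
      using fps_nth_power_prime_power[OF p, of m f "p * n"] p0 by (auto intro: dvd_trans)
    have 2: "int (p ^ N) dvd Stirling_seq p a 0 b 0 (N + i) - (f ^ (p ^ i)) $ (p ^ (N + i) * nat (a - b))" for i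
      using int_Stirling_prime_power_cong[of p b N i "int p ^ (N + i) * a"] assms p0
      by (simp add: Stirling_seq_def f_def n mult_left_mono)
    have "int (p ^ N) dvd Stirling_seq p a 0 b 0 (Suc e) - (f ^ (p ^ Suc m)) $ (p * n)"
      and "int (p ^ N) dvd Stirling_seq p a 0 b 0 e - (f ^ (p ^ m)) $ n"
      using 2[of "Suc m"] 2[of m] by (simp_all add: n_def m(1) mult.assoc)
    from dvd_add[OF dvd_diff[OF this] 1] show ?thesis
      by simp
  qed
  then show ?thesis
    unfolding eventually_sequentially by blast
qed

text \<open>Solved downwards, the recurrence is
  \<open>S(n, k - 1) = S(n + 1, k) - k S(n, k)\<close>. For \<open>k = K - D\<close> the factor
  \<open>- k\<close> is congruent to \<open>D\<close>, which yields the recurrence of the unsigned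
  numbers of the first kind.\<close>

lemma int_Stirling_minus_cong:
  "K dvd int_Stirling n (K - int D) - (\<Sum>j\<le>D. int (stirling D j) * int_Stirling (n + int j) K)"
proof (induction D arbitrary: n)
  case 0
  then show ?case by simp
next
  case (Suc D)
  let ?T = "\<lambda>n. \<Sum>j\<le>D. int (stirling D j) * int_Stirling (n + int j) K"
  let ?U = "\<lambda>n. int_Stirling n (K - int D)"
  have rec: "int_Stirling n (K - int (Suc D)) = ?U (n + 1) - (K - int D) * ?U n"
    using int_Stirling_rec[of "n + 1" "K - int D"] by (simp add: algebra_simps)
  have "(\<Sum>j\<le>Suc D. int (stirling (Suc D) j) * int_Stirling (n + int j) K)
      = int (stirling (Suc D) 0) * int_Stirling n K
        + (\<Sum>j\<le>D. int (stirling (Suc D) (Suc j)) * int_Stirling (n + int (Suc j)) K)"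
    by (simp only: sum.atMost_Suc_shift) simp
  \<comment> \<open>At \<open>j = 0\<close> both sides vanish: \<open>D * stirling D 0 = 0\<close>,
    by the first factor if \<open>D = 0\<close> and by the second otherwise.\<close>
  also have "\<dots> = int D * (int (stirling D 0) * int_Stirling n K
        + (\<Sum>j\<le>D. int (stirling D (Suc j)) * int_Stirling (n + int (Suc j)) K)) + ?T (n + 1)"
    by (cases D) (simp_all add: algebra_simps sum.distrib sum_distrib_left)
  also have "int (stirling D 0) * int_Stirling n K
        + (\<Sum>j\<le>D. int (stirling D (Suc j)) * int_Stirling (n + int (Suc j)) K)
      = (\<Sum>j\<le>Suc D. int (stirling D j) * int_Stirling (n + int j) K)"
    by (simp only: sum.atMost_Suc_shift) simp
  \<comment> \<open>The top term drops out because \<open>stirling D (Suc D) = 0\<close>.\<close>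
  also have "\<dots> = ?T n"
    by simp
  finally have T: "(\<Sum>j\<le>Suc D. int (stirling (Suc D) j) * int_Stirling (n + int j) K)
      = int D * ?T n + ?T (n + 1)" .
  have "K dvd (?U (n + 1) - ?T (n + 1)) + int D * (?U n - ?T n) - K * ?U n"
    using Suc by simp
  also have "\<dots> = int_Stirling n (K - int (Suc D))
      - (\<Sum>j\<le>Suc D. int (stirling (Suc D) j) * int_Stirling (n + int j) K)"
    unfolding rec T by (simp add: algebra_simps)
  finally show ?case .
qed

text \<open>Every summand with \<open>c + j \<noteq> 0\<close> tends to \<open>0\<close>. Writing
  \<open>d\<close> as \<open>- int D\<close> includes \<open>d = 0\<close>.\<close>

lemma eventually_Stirling_seq_minus:
  assumes p: "prime p" and b: "b \<ge> 0"
  shows "\<forall>\<^sub>F e in sequentially. int p ^ N dvd Stirling_seq p a c b (- int D) e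
    - (if c \<le> 0 then int (stirling D (nat (- c))) * Stirling_seq p a 0 b 0 e else 0)"
proof -
  have "\<forall>\<^sub>F e in sequentially. \<forall>j\<in>{..D}. c + int j \<noteq> 0 \<longrightarrow>
      int p ^ N dvd Stirling_seq p a (c + int j) b 0 e"
    using eventually_Stirling_seq_0[OF p b] by (intro eventually_ball_finite) auto
  moreover have "\<forall>\<^sub>F e in sequentially. e \<ge> N"
    by (rule eventually_ge_at_top)
  ultimately show ?thesis
  proof eventually_elim
    case (elim e)
    let ?v = "\<lambda>j. int (stirling D j) * Stirling_seq p a (c + int j) b 0 e"
    let ?L = "if c \<le> 0 then int (stirling D (nat (- c))) * Stirling_seq p a 0 b 0 e else 0"
    have "int p ^ N dvd int p ^ e * b"
      using elim by (intro dvd_mult2 le_imp_power_dvd)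
    then have 1: "int p ^ N dvd Stirling_seq p a c b (- int D) e - (\<Sum>j\<le>D. ?v j)"
      using int_Stirling_minus_cong[of "int p ^ e * b" "int p ^ e * a + c" D]
      by (auto simp: Stirling_seq_def add.assoc intro: dvd_trans)
    \<comment> \<open>If \<open>- c > D\<close>, no index \<open>j\<close> matches, but then
      \<open>stirling D (nat (- c)) = 0\<close>. The guard \<open>c \<le> 0\<close> excludes the
      false match \<open>nat (- c) = 0\<close> for positive \<open>c\<close>.\<close>
    have "?L = (\<Sum>j\<le>D. if j = nat (- c) \<and> c \<le> 0 then ?v j else 0)"
      by (cases "c \<le> 0"; cases "nat (- c) \<le> D") auto
    then have "(\<Sum>j\<le>D. ?v j) - ?L = (\<Sum>j\<le>D. ?v j - (if j = nat (- c) \<and> c \<le> 0 then ?v j else 0))"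
      by (simp only: sum_subtractf)
    moreover have "int p ^ N dvd \<dots>"
      using elim(1) by (intro dvd_sum) auto
    ultimately have 2: "int p ^ N dvd (\<Sum>j\<le>D. ?v j) - ?L"
      by simp
    show ?case
      using dvd_add[OF 1 2] by simp
  qed
qed

section \<open>Limits\<close>

text \<open>By the ultrametric inequality consecutive differences suffice: modulo each
  \<open>p ^ N\<close> the sequence is eventually constant, and these residues form the
  limit.\<close>

lemma padic_convergentI_Suc:
  assumes "p > 0" and u: "\<And>N. \<forall>\<^sub>F e in sequentially. int p ^ N dvd u (Suc e) - u e"
  obtains L where "limitin (padic_topology p) (\<lambda>e. padic_of_int p (u e)) L sequentially"
proof -
  have "\<exists>E. \<forall>e\<ge>E. u e mod int p ^ N = u E mod int p ^ N" for N
  proof -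
    obtain E where E: "\<And>e. e \<ge> E \<Longrightarrow> int p ^ N dvd u (Suc e) - u e"
      using u[of N] unfolding eventually_sequentially by blast
    have "u e mod int p ^ N = u E mod int p ^ N" if "e \<ge> E" for e
      using that by (induction rule: dec_induct) (use E in \<open>simp_all add: mod_eq_dvd_iff[symmetric]\<close>)
    then show ?thesis
      by blast
  qed
  then obtain E where E: "\<And>N e. e \<ge> E N \<Longrightarrow> u e mod int p ^ N = u (E N) mod int p ^ N"
    by metis
  define L where "L N = u (E N) mod int p ^ N" for N
  have "L (Suc N) mod int p ^ N = L N" for N
  proof -
    \<comment> \<open>Beyond both thresholds, \<open>L N\<close> and \<open>L (Suc N)\<close> are
      residues of the same integer \<open>u e\<close>.\<close>
    define e where "e = max (E N) (E (Suc N))"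
    have "L (Suc N) = u e mod int p ^ Suc N" "L N = u e mod int p ^ N"
      using E[of N e] E[of "Suc N" e] by (simp_all add: L_def e_def)
    then show ?thesis
      by (simp add: mod_mod_cancel)
  qed
  then have "L \<in> carrier (padic_int p)"
    using assms(1) by (simp add: padic_int_simps L_def)
  moreover have "\<forall>\<^sub>F e in sequentially. u e mod int p ^ N = L N" for N
    unfolding eventually_sequentially L_def using E by blast
  ultimately show ?thesis
    using that limitin_padic_topology_iff[OF assms(1)] by blast
qed

lemma limitin_padic_scaled:
  assumes "p > 0"
    and v: "limitin (padic_topology p) (\<lambda>e. padic_of_int p (v e)) L sequentially"
    and u: "\<And>N. \<forall>\<^sub>F e in sequentially. int p ^ N dvd u e - s * v e"
  shows "limitin (padic_topology p) (\<lambda>e. padic_of_int p (u e))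
    (padic_of_int p s \<otimes>\<^bsub>padic_int p\<^esub> L) sequentially"
proof -
  interpret cring "padic_int p"
    using assms(1) by (rule cring_padic_int)
  have L: "L \<in> carrier (padic_int p)" "\<And>N. \<forall>\<^sub>F e in sequentially. v e mod int p ^ N = L N"
    using v by (simp_all add: limitin_padic_topology_iff[OF assms(1)])
  have "\<forall>\<^sub>F e in sequentially. u e mod int p ^ N = (padic_of_int p s \<otimes>\<^bsub>padic_int p\<^esub> L) N" for N
    using u[of N] L(2)[of N]
  proof eventually_elim
    case (elim e)
    have "u e mod int p ^ N = s * v e mod int p ^ N"
      using elim(1) by (simp add: mod_eq_dvd_iff)
    then show ?case
      by (simp add: padic_int_simps(2) padic_of_int_def mod_simps flip: elim(2))
  qed
  then show ?thesis
    using L(1) padic_of_int_closed[OF assms(1)] by (simp add: limitin_padic_topology_iff[OF assms(1)])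
qed

theorem theorem1p3:
  fixes p :: nat and a b c d :: int
  assumes "prime p" and "0 \<le> b" and "b \<le> a"
  shows "(d = 0 \<and> c \<noteq> 0 \<longrightarrow>
            padic_convergent p (Stirling_seq p a c b d) \<and>
            padic_Stirling p a c b d = \<zero>\<^bsub>padic_int p\<^esub>) \<and>
         (d < 0 \<and> c \<ge> 0 \<longrightarrow>
            padic_convergent p (Stirling_seq p a c b d) \<and>
            padic_Stirling p a c b d = \<zero>\<^bsub>padic_int p\<^esub>) \<and>
         (c < 0 \<and> d < 0 \<longrightarrow>
            padic_convergent p (Stirling_seq p a c b d) \<and>
            padic_convergent p (Stirling_seq p a 0 b 0) \<and>
            padic_Stirling p a c b d =
              padic_of_int p (int (stirling (nat \<bar>d\<bar>) (nat \<bar>c\<bar>)))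
                \<otimes>\<^bsub>padic_int p\<^esub> padic_Stirling p a 0 b 0)"
proof -
  have p0: "p > 0"
    using assms(1) by (rule prime_gt_0_nat)
  obtain L where L: "limitin (padic_topology p) (\<lambda>e. padic_of_int p (Stirling_seq p a 0 b 0 e)) L sequentially"
    using padic_convergentI_Suc[OF p0 eventually_Stirling_seq_Suc[OF assms]] by blast
  \<comment> \<open>One factor covers all three cases: it vanishes for \<open>c > 0\<close>, and
    \<open>stirling 0 k = stirling k 0 = 0\<close> for \<open>k > 0\<close> settles
    \<open>d = 0\<close>, \<open>c < 0\<close> and \<open>d < 0\<close>,
    \<open>c = 0\<close>.\<close>
  define s where "s = (if c \<le> 0 then int (stirling (nat \<bar>d\<bar>) (nat (- c))) else 0)"
  have lim: "limitin (padic_topology p) (\<lambda>e. padic_of_int p (Stirling_seq p a c b d e))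
      (padic_of_int p s \<otimes>\<^bsub>padic_int p\<^esub> L) sequentially" if "d \<le> 0"
  proof (rule limitin_padic_scaled[OF p0 L])
    show "\<forall>\<^sub>F e in sequentially. int p ^ N dvd Stirling_seq p a c b d e - s * Stirling_seq p a 0 b 0 e" for N
      using eventually_Stirling_seq_minus[OF assms(1,2), of N a c "nat \<bar>d\<bar>"] that
      by (cases "c \<le> 0") (simp_all add: s_def)
  qed
  have "padic_of_int p 0 \<otimes>\<^bsub>padic_int p\<^esub> L = \<zero>\<^bsub>padic_int p\<^esub>"
    by (simp add: padic_int_simps(2,5) padic_of_int_def)
  moreover have "s = 0" if "d = 0 \<and> c \<noteq> 0 \<or> d < 0 \<and> c \<ge> 0"
    using that by (auto simp: s_def)
  ultimately have zero: "padic_convergent p (Stirling_seq p a c b d) \<and>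
      padic_Stirling p a c b d = \<zero>\<^bsub>padic_int p\<^esub>"
    if "d = 0 \<and> c \<noteq> 0 \<or> d < 0 \<and> c \<ge> 0"
    using lim padic_lim_eqI[OF lim] that unfolding padic_convergent_def padic_Stirling_def by auto
  have "padic_convergent p (Stirling_seq p a c b d) \<and> padic_convergent p (Stirling_seq p a 0 b 0) \<and>
      padic_Stirling p a c b d = padic_of_int p (int (stirling (nat \<bar>d\<bar>) (nat \<bar>c\<bar>)))
        \<otimes>\<^bsub>padic_int p\<^esub> padic_Stirling p a 0 b 0" if "c < 0" "d < 0"
    using L lim padic_lim_eqI[OF L] padic_lim_eqI[OF lim] that
    unfolding padic_convergent_def padic_Stirling_def by (auto simp: s_def)
  with zero show ?thesis
    by blast
qed

end
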